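(* Let $m$ be an arbitrary element of an $\mathbb{O}$-bimodule $M$, and let $\{m_i\}_{i=1}^n$ be an arbitrary cyclic decomposition of $m$. Then $$\langle m\rangle_{\mathbb{O}}=\bigoplus_{i=1}^n\mathbb{O}m_i$$ (internal direct sum).
   Context: $\mathbb{O}$ is the real division algebra of octonions. A left $\mathbb{O}$-module is a real vector space $M$ with an $\mathbb{R}$-bilinear map $\mathbb{O}\times M\to M$, $(p,m)\mapsto pm$, such that $1m=m$ and $[p,q,m]=-[q,p,m]$ for all $p,q\in\mathbb{O}$, $m\in M$, where $[p,q,m]:=(pq)m-p(qm)$. An $\mathbb{O}$-bimodule is a left $\mathbb{O}$-module $M$ with in addition an $\mathbb{R}$-bilinear right multiplication $M\times\mathbb{O}\to M$, $(m,p)\mapsto mp$, with $m1=m$, such that $[p,q,m]=[m,p,q]=[q,m,p]$ for all $p,q\in\mathbb{O}$, $m\in M$, where $[m,p,q]:=(mp)q-m(pq)$ and $[q,m,p]:=(qm)p-q(mp)$. $\langle m\rangle_{\mathbb{O}}$ is the (left) $\mathbb{O}$-submodule generated by $m$, and $\mathbb{O}m=\{pm\mid p\in\mathbb{O}\}$. An element $m\in M$ is cyclic if $\langle m\rangle_{\mathbb{O}}=\mathbb{O}m$; $\mathscr{C}(M)$ is the set of cyclic elements. Let $\mathscr{A}(M)=\{x\in M\mid [p,q,x]=0\ \forall p,q\in\mathbb{O}\}$. In an $\mathbb{O}$-bimodule every nonzero cyclic element $c$ can be written as $c=rx$ with $r\in\mathbb{O}$, $x\in\mathscr{A}(M)$;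 such an $r$ is called a characteristic value of $c$ and $x$ the corresponding characteristic vector (both are determined up to nonzero real factors). A cyclic decomposition of $m\in M$ is a finite collection $\{m_i\}_{i=1}^n$ of nonzero cyclic elements with $m=\sum_{i=1}^n m_i$, $m_i=r_ix_i$ with characteristic values $r_i$ and characteristic vectors $x_i$, such that $\{x_i\}_{i=1}^n$ is $\mathbb{R}$-linearly independent in $M$ and $\{r_i\}_{i=1}^n$ is $\mathbb{R}$-linearly independent in $\mathbb{O}$ (for $m=0$ the decomposition is empty, $n=0$). *)

theory Defs
  imports "HOL-Analysis.Linear_Algebra"
begin

section \<open>Octonions\<close>

datatype octo =
  Octo (oc0: real) (oc1: real) (oc2: real) (oc3: real) (oc4: real) (oc5: real) (oc6: real) (oc7: real)

lemma octo_eq_iff: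
  "x = y \<longleftrightarrow> oc0 x = oc0 y \<and> oc1 x = oc1 y \<and> oc2 x = oc2 y \<and> oc3 x = oc3 y \<and> oc4 x = oc4 y \<and> oc5 x = oc5 y \<and> oc6 x = oc6 y \<and> oc7 x = oc7 y"
  by (auto intro: octo.expand)

instantiation octo :: real_vector
begin

definition "0 = Octo 0 0 0 0 0 0 0 0"
definition "x + y = Octo (oc0 x + oc0 y) (oc1 x + oc1 y) (oc2 x + oc2 y) (oc3 x + oc3 y) (oc4 x + oc4 y) (oc5 x + oc5 y) (oc6 x + oc6 y) (oc7 x + oc7 y)"
definition "- x = Octo (- oc0 x) (- oc1 x) (- oc2 x) (- oc3 x) (- oc4 x) (- oc5 x) (- oc6 x) (- oc7 x)"
definition "x - y = Octo (oc0 x - oc0 y) (oc1 x - oc1 y) (oc2 x - oc2 y) (oc3 x - oc3 y) (oc4 x - oc4 y) (oc5 x - oc5 y) (oc6 x - oc6 y) (oc7 x - oc7 y)"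
definition "a *\<^sub>R x = Octo (a * oc0 x) (a * oc1 x) (a * oc2 x) (a * oc3 x) (a * oc4 x) (a * oc5 x) (a * oc6 x) (a * oc7 x)"

instance
  by standard
    (simp_all add: zero_octo_def plus_octo_def uminus_octo_def minus_octo_def scaleR_octo_def
      octo_eq_iff algebra_simps)

end

text \<open>
  The basis is \<open>1, e\<^sub>1, \<dots>, e\<^sub>7\<close> with \<open>e\<^sub>i\<^sup>2 = -1\<close> and, indices being taken modulo 7 in
  \<open>{1, \<dots>, 7}\<close>, \<open>e\<^sub>i e\<^sub>i\<^sub>+\<^sub>1 = e\<^sub>i\<^sub>+\<^sub>3\<close> together with its cyclic permutations, distinct imaginary
  units anticommuting. Hence \<open>e\<^sub>k\<close> equals each of \<open>e\<^sub>k\<^sub>+\<^sub>1 e\<^sub>k\<^sub>+\<^sub>3\<close>, \<open>e\<^sub>k\<^sub>+\<^sub>2 e\<^sub>k\<^sub>+\<^sub>6\<close>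
  and \<open>e\<^sub>k\<^sub>+\<^sub>4 e\<^sub>k\<^sub>+\<^sub>5\<close>, which gives the coordinate formula below.
\<close>

instantiation octo :: "{one, times}"
begin

definition "1 = Octo 1 0 0 0 0 0 0 0"
definition "x * y = Octo
    (oc0 x * oc0 y - oc1 x * oc1 y - oc2 x * oc2 y - oc3 x * oc3 y - oc4 x * oc4 y - oc5 x * oc5 y - oc6 x * oc6 y - oc7 x * oc7 y)
    (oc0 x * oc1 y + oc1 x * oc0 y + oc2 x * oc4 y - oc4 x * oc2 y + oc3 x * oc7 y - oc7 x * oc3 y + oc5 x * oc6 y - oc6 x * oc5 y)
    (oc0 x * oc2 y + oc2 x * oc0 y + oc3 x * oc5 y - oc5 x * oc3 y + oc4 x * oc1 y - oc1 x * oc4 y + oc6 x * oc7 y - oc7 x * oc6 y)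
    (oc0 x * oc3 y + oc3 x * oc0 y + oc4 x * oc6 y - oc6 x * oc4 y + oc5 x * oc2 y - oc2 x * oc5 y + oc7 x * oc1 y - oc1 x * oc7 y)
    (oc0 x * oc4 y + oc4 x * oc0 y + oc5 x * oc7 y - oc7 x * oc5 y + oc6 x * oc3 y - oc3 x * oc6 y + oc1 x * oc2 y - oc2 x * oc1 y)
    (oc0 x * oc5 y + oc5 x * oc0 y + oc6 x * oc1 y - oc1 x * oc6 y + oc7 x * oc4 y - oc4 x * oc7 y + oc2 x * oc3 y - oc3 x * oc2 y)
    (oc0 x * oc6 y + oc6 x * oc0 y + oc7 x * oc2 y - oc2 x * oc7 y + oc1 x * oc5 y - oc5 x * oc1 y + oc3 x * oc4 y - oc4 x * oc3 y)
    (oc0 x * oc7 y + oc7 x * oc0 y + oc1 x * oc3 y - oc3 x * oc1 y + oc2 x * oc6 y - oc6 x * oc2 y + oc4 x * oc5 y - oc5 x * oc4 y)"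

instance ..

end

lemmas octo_defs =
  zero_octo_def plus_octo_def uminus_octo_def minus_octo_def scaleR_octo_def
  one_octo_def times_octo_def

lemma bilinear_octo_times: "bilinear ((*) :: octo \<Rightarrow> octo \<Rightarrow> octo)"
  unfolding bilinear_def
  by (intro conjI allI linearI) (simp_all add: octo_defs octo_eq_iff algebra_simps)

lemma octo_one_left: "1 * x = x" and octo_one_right: "x * 1 = x" for x :: octo
  by (simp_all add: octo_defs octo_eq_iff)

text \<open>
  Unital, eight-dimensional, alternative and with a multiplicative positive definite quadratic
  form: by Hurwitz' theorem these properties identify the octonions.
\<close>

lemma octo_alternative_left: "(x * x) * y = x * (x * y)"
  and octo_alternative_right: "(y * x) * x = y * (x * x)" for x y :: octo
  by (simp_all add: octo_defs octo_eq_iff, simp_all add: algebra_simps)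

definition octo_normsq :: "octo \<Rightarrow> real" where
  "octo_normsq x = (oc0 x)\<^sup>2 + (oc1 x)\<^sup>2 + (oc2 x)\<^sup>2 + (oc3 x)\<^sup>2 + (oc4 x)\<^sup>2 + (oc5 x)\<^sup>2 + (oc6 x)\<^sup>2 + (oc7 x)\<^sup>2"

lemma octo_normsq_eq_0_iff: "octo_normsq x = 0 \<longleftrightarrow> x = 0"
  by (simp add: octo_normsq_def octo_defs octo_eq_iff add_nonneg_eq_0_iff)

lemma octo_normsq_mult: "octo_normsq (x * y) = octo_normsq x * octo_normsq y"
  by (simp add: octo_normsq_def octo_defs power2_eq_square, simp add: algebra_simps)

lemma octo_no_zero_divisors: "x * y = 0 \<longleftrightarrow> x = 0 \<or> y = 0" for x y :: octo
  by (metis mult_eq_0_iff octo_normsq_eq_0_iff octo_normsq_mult)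


section \<open>Octonionic modules and bimodules\<close>

locale octo_left_module =
  fixes lm :: "octo \<Rightarrow> 'm::real_vector \<Rightarrow> 'm"
  assumes bilinear_lm: "bilinear lm"
    and lm_one: "lm 1 m = m"
    and lm_assoc_alternating:
      "lm (p * q) m - lm p (lm q m) = - (lm (q * p) m - lm q (lm p m))"

locale octo_bimodule = octo_left_module lm
  for lm :: "octo \<Rightarrow> 'm::real_vector \<Rightarrow> 'm" +
  fixes rm :: "'m \<Rightarrow> octo \<Rightarrow> 'm"
  assumes bilinear_rm: "bilinear rm"
    and rm_one: "rm m 1 = m"
    and assoc_left_right:
      "lm (p * q) m - lm p (lm q m) = rm (rm m p) q - rm m (p * q)"
    and assoc_right_mid:
      "rm (rm m p) q - rm m (p * q) = rm (lm q m) p - lm q (rm m p)"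

lemma octo_bimodule_octo: "octo_bimodule ((*) :: octo \<Rightarrow> octo \<Rightarrow> octo) (*)"
proof
  fix p q m :: octo
  have group: "a - b = - (c - d)" if "a + c = b + d" for a b c d :: octo
    using that by (simp add: algebra_simps)
  note distrib = bilinear_ladd[OF bilinear_octo_times] bilinear_radd[OF bilinear_octo_times]
  have left: "(p * q) * m - p * (q * m) = - ((q * p) * m - q * (p * m))" for p q m :: octo
    using octo_alternative_left[of "p + q" m] by (intro group) (simp add: distrib octo_alternative_left ac_simps)
  have right: "(m * p) * q - m * (p * q) = - ((m * q) * p - m * (q * p))" for p q m :: octo
    using octo_alternative_right[of m "p + q"] by (intro group) (simp add: distrib octo_alternative_right ac_simps)
  show "bilinear ((*) :: octo \<Rightarrow> octo \<Rightarrow> octo)"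
    by (rule bilinear_octo_times)
  show "1 * m = m" "m * 1 = m"
    by (rule octo_one_left octo_one_right)+
  show "(p * q) * m - p * (q * m) = - ((q * p) * m - q * (p * m))"
    by (rule left)
  show "(p * q) * m - p * (q * m) = (m * p) * q - m * (p * q)"
    using left[of m p q] right[of p m q] by simp
qed

definition octo_submodule :: "(octo \<Rightarrow> 'm::real_vector \<Rightarrow> 'm) \<Rightarrow> 'm set \<Rightarrow> bool" where
  "octo_submodule lm N \<longleftrightarrow> subspace N \<and> (\<forall>p. \<forall>v\<in>N. lm p v \<in> N)"

definition octo_generated :: "(octo \<Rightarrow> 'm::real_vector \<Rightarrow> 'm) \<Rightarrow> 'm \<Rightarrow> 'm set" where
  "octo_generated lm m = octo_submodule lm hull {m}"

definition octo_multiples :: "(octo \<Rightarrow> 'm::real_vector \<Rightarrow> 'm) \<Rightarrow> 'm \<Rightarrow> 'm set" where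
  "octo_multiples lm m = {lm p m | p. True}"

definition octo_cyclic :: "(octo \<Rightarrow> 'm::real_vector \<Rightarrow> 'm) \<Rightarrow> 'm \<Rightarrow> bool" where
  "octo_cyclic lm m \<longleftrightarrow> octo_generated lm m = octo_multiples lm m"

definition octo_associative :: "(octo \<Rightarrow> 'm::real_vector \<Rightarrow> 'm) \<Rightarrow> 'm set" where
  "octo_associative lm = {x. \<forall>p q. lm (p * q) x - lm p (lm q x) = 0}"

text \<open>
  Linear independence of a family: the library's \<open>independent\<close> is about sets, so that
  repetitions have to be excluded separately.
\<close>

definition independent_family :: "nat set \<Rightarrow> (nat \<Rightarrow> 'v::real_vector) \<Rightarrow> bool" where
  "independent_family I v \<longleftrightarrow> inj_on v I \<and> independent (v ` I)"

text \<open>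
  \<open>r i\<close> and \<open>x i\<close> are a characteristic value and vector of \<open>c i\<close>. As these are determined only up
  to nonzero real factors, which do not affect linear independence, they are quantified
  existentially. The case \<open>n = 0\<close> is the empty decomposition of \<open>0\<close>.
\<close>

definition cyclic_decomposition ::
    "(octo \<Rightarrow> 'm::real_vector \<Rightarrow> 'm) \<Rightarrow> 'm \<Rightarrow> nat \<Rightarrow> (nat \<Rightarrow> 'm) \<Rightarrow> bool" where
  "cyclic_decomposition lm m n c \<longleftrightarrow>
     (\<forall>i\<in>{1..n}. c i \<noteq> 0 \<and> octo_cyclic lm (c i)) \<and>
     m = (\<Sum>i=1..n. c i) \<and>
     (\<exists>r x. (\<forall>i\<in>{1..n}. x i \<in> octo_associative lm \<and> c i = lm (r i) (x i)) \<and>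
            independent_family {1..n} x \<and> independent_family {1..n} r)"

definition internal_direct_sum ::
    "(octo \<Rightarrow> 'm::real_vector \<Rightarrow> 'm) \<Rightarrow> 'm set \<Rightarrow> nat set \<Rightarrow> (nat \<Rightarrow> 'm set) \<Rightarrow> bool" where
  "internal_direct_sum lm N I A \<longleftrightarrow>
     (\<forall>i\<in>I. octo_submodule lm (A i)) \<and>
     N = {\<Sum>i\<in>I. v i | v. \<forall>i\<in>I. v i \<in> A i} \<and>
     (\<forall>v w. (\<forall>i\<in>I. v i \<in> A i \<and> w i \<in> A i) \<and> (\<Sum>i\<in>I. v i) = (\<Sum>i\<in>I. w i)
        \<longrightarrow> (\<forall>i\<in>I. v i = w i))"

end

(* Left multiplications commute with forming r x for x in A(M), so every operator T in the algebra
   generated by the left multiplications of the octonions maps a sum of r_i x_i lying in a submodule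
   to a sum of T(r_i) x_i lying in the same submodule. This algebra consists of all real-linear
   endomorphisms of the octonions, so linear independence of the r_i lets T isolate one summand of m.
   Directness is the same principle for the submodule 0, with T taking real multiples of 1 as values,
   together with linear independence of the x_i. *)
theory Submission
  imports Defs
begin

text \<open>Real scaling needs no rule of its own: it is left multiplication by a real multiple of
  1.\<close>

inductive_set left_mult_algebra :: "(octo \<Rightarrow> octo) set" where
  left_mult: "(*) p \<in> left_mult_algebra"
| comp: "S \<in> left_mult_algebra \<Longrightarrow> T \<in> left_mult_algebra \<Longrightarrow> (\<lambda>q. S (T q)) \<in> left_mult_algebra"
| add: "S \<in> left_mult_algebra \<Longrightarrow> T \<in> left_mult_algebra \<Longrightarrow> (\<lambda>q. S q + T q) \<in> left_mult_algebra"

text \<open>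
  For a quaternionic triple \<open>e\<^sub>i e\<^sub>j = e\<^sub>k\<close> the operator \<open>q \<mapsto> e\<^sub>i (e\<^sub>j (e\<^sub>k q))\<close> is \<open>-1\<close> on the span
  of \<open>1, e\<^sub>i, e\<^sub>j, e\<^sub>k\<close> and \<open>1\<close> on the span of the other units, which gives the projection onto that
  quaternion subalgebra. The triples \<open>124\<close>, \<open>235\<close>, \<open>137\<close> have no common index.
\<close>

lemma real_part_in_left_mult_algebra: "(\<lambda>q. oc0 q *\<^sub>R 1) \<in> left_mult_algebra"
proof -
  \<comment> \<open>\<open>Octo (1/2) 0 0 0 0 0 0 0\<close> is the real scalar 1/2, so
    \<open>P a b c\<close> is half of the identity minus the threefold left multiplication,
    expressed by left multiplications alone.\<close>
  define P where "P a b c q = Octo (1/2) 0 0 0 0 0 0 0 * q + Octo (- 1/2) 0 0 0 0 0 0 0 * (a * (b * (c * q)))"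
    for a b c q :: octo
  have P: "P a b c \<in> left_mult_algebra" for a b c
  proof -
    note left_comp = left_mult_algebra.comp [OF left_mult_algebra.left_mult]
    show ?thesis
      unfolding P_def [abs_def]
      by (rule left_mult_algebra.add [OF left_mult_algebra.left_mult
            left_comp [OF left_comp [OF left_comp [OF left_mult_algebra.left_mult]]]])
  qed
  define e1 where "e1 = Octo 0 1 0 0 0 0 0 0"
  define e2 where "e2 = Octo 0 0 1 0 0 0 0 0"
  define e3 where "e3 = Octo 0 0 0 1 0 0 0 0"
  define e4 where "e4 = Octo 0 0 0 0 1 0 0 0"
  define e5 where "e5 = Octo 0 0 0 0 0 1 0 0"
  define e7 where "e7 = Octo 0 0 0 0 0 0 0 1"
  have "P e1 e2 e4 q = Octo (oc0 q) (oc1 q) (oc2 q) 0 (oc4 q) 0 0 0"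
    and "P e2 e3 e5 q = Octo (oc0 q) 0 (oc2 q) (oc3 q) 0 (oc5 q) 0 0"
    and "P e1 e3 e7 q = Octo (oc0 q) (oc1 q) 0 (oc3 q) 0 0 0 (oc7 q)" for q
    by (simp_all add: P_def e1_def e2_def e3_def e4_def e5_def e7_def octo_defs octo_eq_iff)
  then have "(\<lambda>q. oc0 q *\<^sub>R 1) = (\<lambda>q. P e1 e2 e4 (P e2 e3 e5 (P e1 e3 e7 q)))"
    by (simp add: octo_defs)
  moreover have "(\<lambda>q. P e1 e2 e4 (P e2 e3 e5 (P e1 e3 e7 q))) \<in> left_mult_algebra"
    by (rule left_mult_algebra.comp [OF P left_mult_algebra.comp [OF P P]])
  ultimately show ?thesis
    by (simp only:)
qed

lemma linear_octo_expand:
  fixes T :: "octo \<Rightarrow> 'v::real_vector"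
  assumes "linear T"
  shows "T q =
    oc0 q *\<^sub>R T (Octo 1 0 0 0 0 0 0 0) + oc1 q *\<^sub>R T (Octo 0 1 0 0 0 0 0 0) +
    oc2 q *\<^sub>R T (Octo 0 0 1 0 0 0 0 0) + oc3 q *\<^sub>R T (Octo 0 0 0 1 0 0 0 0) +
    oc4 q *\<^sub>R T (Octo 0 0 0 0 1 0 0 0) + oc5 q *\<^sub>R T (Octo 0 0 0 0 0 1 0 0) +
    oc6 q *\<^sub>R T (Octo 0 0 0 0 0 0 1 0) + oc7 q *\<^sub>R T (Octo 0 0 0 0 0 0 0 1)"
proof -
  have "q =
    oc0 q *\<^sub>R Octo 1 0 0 0 0 0 0 0 + oc1 q *\<^sub>R Octo 0 1 0 0 0 0 0 0 +
    oc2 q *\<^sub>R Octo 0 0 1 0 0 0 0 0 + oc3 q *\<^sub>R Octo 0 0 0 1 0 0 0 0 +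
    oc4 q *\<^sub>R Octo 0 0 0 0 1 0 0 0 + oc5 q *\<^sub>R Octo 0 0 0 0 0 1 0 0 +
    oc6 q *\<^sub>R Octo 0 0 0 0 0 0 1 0 + oc7 q *\<^sub>R Octo 0 0 0 0 0 0 0 1"
    by (simp add: octo_defs octo_eq_iff)
  then have "T q = T (
    oc0 q *\<^sub>R Octo 1 0 0 0 0 0 0 0 + oc1 q *\<^sub>R Octo 0 1 0 0 0 0 0 0 +
    oc2 q *\<^sub>R Octo 0 0 1 0 0 0 0 0 + oc3 q *\<^sub>R Octo 0 0 0 1 0 0 0 0 +
    oc4 q *\<^sub>R Octo 0 0 0 0 1 0 0 0 + oc5 q *\<^sub>R Octo 0 0 0 0 0 1 0 0 +
    oc6 q *\<^sub>R Octo 0 0 0 0 0 0 1 0 + oc7 q *\<^sub>R Octo 0 0 0 0 0 0 0 1)"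
    by (rule arg_cong)
  then show ?thesis
    by (simp only: linear_add [OF assms] linear_scale [OF assms])
qed

text \<open>Since each imaginary unit squares to -1, every coordinate of \<open>q\<close> is the
  real part of \<open>q\<close> multiplied on the left by a conjugate unit. Following this by left
  multiplication by \<open>b\<close> gives all operators of the form coordinate times
  \<open>b\<close>, and \<open>T\<close> is a sum of eight of them, with \<open>b\<close> the image
  of a unit.\<close>

lemma linear_in_left_mult_algebra:
  assumes "linear T"
  shows "T \<in> left_mult_algebra"
proof -
  define R where "R a q = oc0 (a * q) *\<^sub>R (1::octo)" for a q :: octo
  have R: "(\<lambda>q. b * R a q) \<in> left_mult_algebra" for a b
    unfolding R_def
    by (rule left_mult_algebra.comp [OF left_mult_algebra.left_mult
          left_mult_algebra.comp [OF real_part_in_left_mult_algebra left_mult_algebra.left_mult]])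
  have coord:
    "oc0 q *\<^sub>R b = b * R (Octo 1 0 0 0 0 0 0 0) q"
    "oc1 q *\<^sub>R b = b * R (Octo 0 (- 1) 0 0 0 0 0 0) q"
    "oc2 q *\<^sub>R b = b * R (Octo 0 0 (- 1) 0 0 0 0 0) q"
    "oc3 q *\<^sub>R b = b * R (Octo 0 0 0 (- 1) 0 0 0 0) q"
    "oc4 q *\<^sub>R b = b * R (Octo 0 0 0 0 (- 1) 0 0 0) q"
    "oc5 q *\<^sub>R b = b * R (Octo 0 0 0 0 0 (- 1) 0 0) q"
    "oc6 q *\<^sub>R b = b * R (Octo 0 0 0 0 0 0 (- 1) 0) q"
    "oc7 q *\<^sub>R b = b * R (Octo 0 0 0 0 0 0 0 (- 1)) q" for q b
    by (simp_all add: R_def octo_defs)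
  show ?thesis
    by (subst linear_octo_expand [OF assms, abs_def], unfold coord) (intro left_mult_algebra.add R)
qed

text \<open>Injectivity lets \<open>inv_into\<close> carry coefficients from indices to vectors,
  where the independence of the image set applies.\<close>

lemma independent_family_sum_zero:
  assumes "finite I" and "independent_family I x"
    and "(\<Sum>i\<in>I. a i *\<^sub>R x i) = 0" and "j \<in> I"
  shows "a j = 0"
proof -
  have inj: "inj_on x I" and ind: "independent (x ` I)"
    using assms(2) by (auto simp: independent_family_def)
  have "(\<Sum>v\<in>x ` I. a (inv_into I x v) *\<^sub>R v) = (\<Sum>i\<in>I. a i *\<^sub>R x i)"
    by (simp add: sum.reindex [OF inj] inj)
  then have "a (inv_into I x (x j)) = 0"
    using independentD [OF ind finite_imageI [OF assms(1)] subset_refl, of "\<lambda>v. a (inv_into I x v)" "x j"]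
      assms(3,4) by simp
  then show ?thesis
    using inj assms(4) by simp
qed

text \<open>Prescribed values on an independent set extend linearly; injectivity ensures that the
  value \<open>w\<close> is attached to the index \<open>j\<close> alone.\<close>

lemma independent_family_linear_delta:
  fixes x :: "nat \<Rightarrow> 'v::real_vector" and w :: "'w::real_vector"
  assumes "independent_family I x" and "j \<in> I"
  obtains T where "linear T" and "\<And>i. i \<in> I \<Longrightarrow> T (x i) = (if i = j then w else 0)"
proof -
  have inj: "inj_on x I" and ind: "independent (x ` I)"
    using assms(1) by (auto simp: independent_family_def)
  obtain T where lin: "linear T" and T: "\<forall>v\<in>x ` I. T v = (if v = x j then w else 0)"
    using linear_independent_extend [OF ind, of "\<lambda>v. if v = x j then w else 0"] by blast
  have "T (x i) = (if i = j then w else 0)" if "i \<in> I" for i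
    using T that assms(2) inj by (simp add: inj_on_eq_iff)
  with lin show ?thesis
    by (rule that)
qed

lemma octo_submodule_sum_sets:
  assumes linear_lm: "\<And>p. linear (lm p)"
    and sub: "\<And>i. i \<in> I \<Longrightarrow> octo_submodule lm (A i)"
  shows "octo_submodule lm {\<Sum>i\<in>I. v i | v. \<forall>i\<in>I. v i \<in> A i}" (is "octo_submodule lm ?S")
proof -
  have ss: "subspace (A i)" and mult: "\<And>p v. v \<in> A i \<Longrightarrow> lm p v \<in> A i" if "i \<in> I" for i
    using sub that by (auto simp: octo_submodule_def)
  have "0 \<in> ?S"
    by (rule CollectI, rule exI [of _ "\<lambda>_. 0"]) (simp add: ss subspace_0)
  moreover have "a + b \<in> ?S" if a: "a \<in> ?S" and b: "b \<in> ?S" for a b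
  proof -
    obtain v w where "a = (\<Sum>i\<in>I. v i)" "b = (\<Sum>i\<in>I. w i)" "\<forall>i\<in>I. v i \<in> A i" "\<forall>i\<in>I. w i \<in> A i"
      using a b by auto
    then show ?thesis
      by (intro CollectI exI [of _ "\<lambda>i. v i + w i"]) (simp add: sum.distrib ss subspace_add)
  qed
  moreover have "t *\<^sub>R a \<in> ?S" if a: "a \<in> ?S" for t a
  proof -
    obtain v where "a = (\<Sum>i\<in>I. v i)" "\<forall>i\<in>I. v i \<in> A i"
      using a by auto
    then show ?thesis
      by (intro CollectI exI [of _ "\<lambda>i. t *\<^sub>R v i"]) (simp add: scaleR_sum_right ss subspace_scale)
  qed
  moreover have "lm p a \<in> ?S" if a: "a \<in> ?S" for p a
  proof -
    obtain v where "a = (\<Sum>i\<in>I. v i)" "\<forall>i\<in>I. v i \<in> A i"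
      using a by auto
    then show ?thesis
      by (intro CollectI exI [of _ "\<lambda>i. lm p (v i)"]) (simp add: linear_sum [OF linear_lm] mult)
  qed
  ultimately show ?thesis
    unfolding octo_submodule_def subspace_def by (intro conjI ballI allI)
qed

lemma octo_submodule_Inter:
  "(\<And>N. N \<in> F \<Longrightarrow> octo_submodule lm N) \<Longrightarrow> octo_submodule lm (\<Inter>F)"
  unfolding octo_submodule_def by (blast intro: subspace_Inter)

lemma octo_submodule_generated: "octo_submodule lm (octo_generated lm m)"
  unfolding octo_generated_def by (rule hull_in) (blast intro: octo_submodule_Inter)

lemma octo_associative_mult: "x \<in> octo_associative lm \<Longrightarrow> lm p (lm q x) = lm (p * q) x"
  by (simp add: octo_associative_def)

context octo_left_module
begin

lemma linear_lm: "linear (lm p)"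
  using bilinear_lm by (simp add: bilinear_def)

text \<open>Induction on the generation of \<open>T\<close>. For a left multiplication,
  associativity of the \<open>x i\<close> moves the factor out of the sum, and the submodule absorbs
  it.\<close>

lemma submodule_sum_left_mult_algebra:
  assumes N: "octo_submodule lm N" and x: "\<And>i. i \<in> I \<Longrightarrow> x i \<in> octo_associative lm"
    and "T \<in> left_mult_algebra" and "(\<Sum>i\<in>I. lm (r i) (x i)) \<in> N"
  shows "(\<Sum>i\<in>I. lm (T (r i)) (x i)) \<in> N"
  using assms(3,4)
proof (induction arbitrary: r)
  case (left_mult p)
  have "(\<Sum>i\<in>I. lm (p * r i) (x i)) = lm p (\<Sum>i\<in>I. lm (r i) (x i))"
    by (simp add: linear_sum [OF linear_lm] octo_associative_mult x)
  then show ?case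
    using left_mult N by (simp add: octo_submodule_def)
next
  case (comp S T)
  show ?case
    \<comment> \<open>The hypothesis for \<open>S\<close> is applied to the coefficients
      \<open>T (r i)\<close>, which is why \<open>r\<close> is kept arbitrary.\<close>
    by (rule comp.IH(1) [OF comp.IH(2) [OF comp.prems]])
next
  case (add S T)
  then show ?case
    using N by (simp add: bilinear_ladd [OF bilinear_lm] sum.distrib octo_submodule_def subspace_add)
qed

text \<open>If \<open>q j\<close> were nonzero, some real functional \<open>f\<close> would take the
  value 1 there. The operator sending \<open>p\<close> to \<open>f p\<close> times 1 would turn the
  octonionic relation into a real one among the \<open>x i\<close>, forcing \<open>f (q j)\<close>
  to vanish.\<close>

lemma independent_associative_sum_zero:
  assumes "finite I" and x: "\<And>i. i \<in> I \<Longrightarrow> x i \<in> octo_associative lm"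
    and "independent_family I x" and zero: "(\<Sum>i\<in>I. lm (q i) (x i)) = 0" and "j \<in> I"
  shows "q j = 0"
proof (rule ccontr)
  assume "q j \<noteq> 0"
  then have "independent {q j}"
    by simp
  then obtain f :: "octo \<Rightarrow> real" where "linear f" and f: "f (q j) = 1"
    using linear_independent_extend [of "{q j}" "\<lambda>_. 1"] by auto
  then have "linear (\<lambda>p. f p *\<^sub>R (1::octo))"
    by (intro linearI) (simp_all add: linear_add linear_scale scaleR_add_left)
  moreover have "octo_submodule lm {0}"
    by (simp add: octo_submodule_def linear_0 [OF linear_lm])
  ultimately have "(\<Sum>i\<in>I. lm (f (q i) *\<^sub>R 1) (x i)) \<in> {0}"
    using submodule_sum_left_mult_algebra [of "{0}" I x "\<lambda>p. f p *\<^sub>R 1" q]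
    by (simp add: linear_in_left_mult_algebra x zero)
  then have "(\<Sum>i\<in>I. f (q i) *\<^sub>R x i) = 0"
    by (simp add: bilinear_lmul [OF bilinear_lm] lm_one)
  then have "f (q j) = 0"
    by (rule independent_family_sum_zero [OF \<open>finite I\<close> \<open>independent_family I x\<close> _ \<open>j \<in> I\<close>])
  then show False
    using f by simp
qed

text \<open>The operator that fixes \<open>r j\<close> and kills the other \<open>r i\<close>
  isolates the summand with index \<open>j\<close>.\<close>

lemma summand_in_submodule:
  assumes "finite I" and x: "\<And>i. i \<in> I \<Longrightarrow> x i \<in> octo_associative lm"
    and r: "independent_family I r" and N: "octo_submodule lm N"
    and sum: "(\<Sum>i\<in>I. lm (r i) (x i)) \<in> N" and "j \<in> I"
  shows "lm (r j) (x j) \<in> N"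
proof -
  obtain T where T: "linear T" "\<And>i. i \<in> I \<Longrightarrow> T (r i) = (if i = j then r j else 0)"
    using independent_family_linear_delta [OF r \<open>j \<in> I\<close>] by metis
  have "(\<Sum>i\<in>I. lm (T (r i)) (x i)) = (\<Sum>i\<in>I. if i = j then lm (r j) (x j) else 0)"
    by (intro sum.cong) (auto simp: T(2) bilinear_lzero [OF bilinear_lm])
  then show ?thesis
    using submodule_sum_left_mult_algebra [OF N x linear_in_left_mult_algebra [OF T(1)] sum]
      assms(1) \<open>j \<in> I\<close> by simp
qed

end

theorem theorem1p2:
  fixes lm :: "octo \<Rightarrow> 'm::real_vector \<Rightarrow> 'm"
    and rm :: "'m \<Rightarrow> octo \<Rightarrow> 'm"
    and m :: 'm and n :: nat and c :: "nat \<Rightarrow> 'm"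
  assumes "octo_bimodule lm rm"
    and "cyclic_decomposition lm m n c"
  shows "internal_direct_sum lm (octo_generated lm m) {1..n} (\<lambda>i. octo_multiples lm (c i))"
proof -
  interpret octo_bimodule lm rm
    by fact
  let ?I = "{1..n}" and ?A = "\<lambda>i. octo_multiples lm (c i)"
  let ?S = "{\<Sum>i\<in>?I. v i | v. \<forall>i\<in>?I. v i \<in> ?A i}"
  obtain r x where cyc: "\<And>i. i \<in> ?I \<Longrightarrow> octo_cyclic lm (c i)" and m: "m = (\<Sum>i\<in>?I. c i)"
    and x: "\<And>i. i \<in> ?I \<Longrightarrow> x i \<in> octo_associative lm"
    and c: "\<And>i. i \<in> ?I \<Longrightarrow> c i = lm (r i) (x i)"
    and indx: "independent_family ?I x" and indr: "independent_family ?I r"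
    using assms(2) unfolding cyclic_decomposition_def by blast
  \<comment> \<open>Cyclicity enters here: it identifies the set of multiples with a generated
    submodule.\<close>
  have sub: "octo_submodule lm (?A i)" if "i \<in> ?I" for i
    using cyc [OF that] octo_submodule_generated [of lm "c i"] by (simp add: octo_cyclic_def)
  have gen: "octo_submodule lm (octo_generated lm m)"
    by (rule octo_submodule_generated)
  have "m \<in> octo_generated lm m"
    by (simp add: octo_generated_def hull_inc)
  then have "(\<Sum>i\<in>?I. lm (r i) (x i)) \<in> octo_generated lm m"
    using c m by simp
  then have "c i \<in> octo_generated lm m" if "i \<in> ?I" for i
    using summand_in_submodule [OF _ x indr gen _ that] c [OF that] by simp
  then have "?A i \<subseteq> octo_generated lm m" if "i \<in> ?I" for i
    using gen that by (auto simp: octo_multiples_def octo_submodule_def)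
  then have "(\<Sum>i\<in>?I. v i) \<in> octo_generated lm m" if "\<forall>i\<in>?I. v i \<in> ?A i" for v
    using gen that by (intro subspace_sum) (blast intro: octo_submodule_def [THEN iffD1, THEN conjunct1])+
  then have "?S \<subseteq> octo_generated lm m"
    by auto
  have "c i \<in> ?A i" for i
    unfolding octo_multiples_def by (intro CollectI exI [of _ 1]) (simp add: lm_one)
  then have "m \<in> ?S"
    using m by (intro CollectI exI [of _ c]) simp
  moreover have "octo_submodule lm ?S"
    by (rule octo_submodule_sum_sets [OF linear_lm sub])
  ultimately have "octo_generated lm m \<subseteq> ?S"
    unfolding octo_generated_def by (intro hull_minimal) simp_all
  with \<open>?S \<subseteq> octo_generated lm m\<close> have "octo_generated lm m = ?S"
    by (rule subset_antisym [rotated])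
  moreover have "v j = w j"
    if vw: "\<forall>i\<in>?I. v i \<in> ?A i \<and> w i \<in> ?A i" and eq: "(\<Sum>i\<in>?I. v i) = (\<Sum>i\<in>?I. w i)"
      and j: "j \<in> ?I" for v w j
  proof -
    \<comment> \<open>Because \<open>x i\<close> is associative, both components are octonion
      multiples of \<open>x i\<close> itself, so uniqueness reduces to the vanishing of coefficients
      in a zero sum.\<close>
    have "\<forall>i\<in>?I. \<exists>q. v i - w i = lm q (x i)"
    proof
      fix i assume i: "i \<in> ?I"
      then obtain p p' where "v i = lm p (c i)" "w i = lm p' (c i)"
        using vw [THEN bspec, OF i] unfolding octo_multiples_def by blast
      then have "v i - w i = lm (p * r i - p' * r i) (x i)"
        by (simp add: c [OF i] x [OF i] octo_associative_mult bilinear_lsub [OF bilinear_lm])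
      then show "\<exists>q. v i - w i = lm q (x i)" ..
    qed
    then obtain q where q: "\<And>i. i \<in> ?I \<Longrightarrow> v i - w i = lm (q i) (x i)"
      by metis
    then have "(\<Sum>i\<in>?I. lm (q i) (x i)) = (\<Sum>i\<in>?I. v i - w i)"
      by simp
    also have "\<dots> = 0"
      using eq by (simp add: sum_subtractf)
    finally have "q j = 0"
      using independent_associative_sum_zero [OF _ x indx _ j] by simp
    then show ?thesis
      using q [OF j] by (simp add: bilinear_lzero [OF bilinear_lm])
  qed
  ultimately show ?thesis
    unfolding internal_direct_sum_def using sub by (intro conjI ballI allI impI) simp_all
qed

end
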